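(* Suppose that $\nabla f$ is $L_f$-Lipschitz continuous; $h$ is proper, closed and convex (not necessarily differentiable); $F=f+h$ is bounded below by $F_{\mathrm{low}}$; the approximate gradients satisfy $\|g_k-\nabla f(x_k)\|\le\kappa_{\mathrm{eg}}\Delta_k$ with a constant $\kappa_{\mathrm{eg}}>0$ independent of $k$; the approximate Hessians satisfy $\underline\kappa I\preceq H_k\preceq\bar\kappa I$ for all $k\in\mathbb{N}$ with constants $\bar\kappa\ge\underline\kappa>0$; and $f$ is convex and $F$ is strongly convex, with modulus $m>0$. Let $x^\star$ be the unique minimizer of $F$ and let $$\underline t:=\beta\min\left\{1,\frac{\underline\kappa\gamma(1-2c_1)}{L_f},\frac{2\underline\kappa\gamma nc_2}{\kappa_{\mathrm{eg}}^2}\right\}.$$ Then, for any integer $T\ge1$, the algorithm ZOPN (described in the context) satisfies $$F(x_T)-F(x^\star)\le\tilde\tau^{T}(F(x_0)-F(x^\star))+(nc_2+\tilde\varpi\kappa_{\mathrm{eg}}^2)\,\tilde\tau^{T-1}\sum_{k=0}^{T-1}\frac{\Delta_k^2}{\tilde\tau^k},$$ where $\tilde\tau,\tilde\varpi$ are the constants $$\tilde\tau:=1-\frac{c_1\underline t\,\underline\kappa\gamma}{4\underline\kappa\gamma+\frac{16\bar\kappa^2}{m}+2L_f}\in(0,1),\qquad\tilde\varpi:=\frac{c_1\underline t\,\underline\kappa\gamma(1/L_f+8/m)}{4\underline\kappa\gamma+\frac{16\bar\kappa^2}{m}+2L_f}>0.$$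
   Context: Setting: $F=f+h$, where $f:\mathbb{R}^n\to\mathbb{R}$ is continuously differentiable and accessible only through function values, and $h:\mathbb{R}^n\to\mathbb{R}\cup\{+\infty\}$. $\|\cdot\|$ is the Euclidean norm for vectors and the spectral norm for matrices, $\|x\|_A=\sqrt{x^\top Ax}$ for symmetric positive definite $A$, and $\partial F(x)=\nabla f(x)+\partial h(x)$. Strong convexity of $F$ with modulus $m$ means $F(x)\ge F(y)+q^\top(x-y)+\frac m2\|x-y\|^2$ for all $x,y\in\mathbb{R}^n$ and all $q\in\partial F(y)$. Algorithm ZOPN. Inputs: $x_0\in\mathrm{dom}\,F$, tolerance $\epsilon\ge0$, $c_1\in(0,1/2)$, $c_2>0$, $\beta\in(0,1)$, $\gamma\in(0,1]$, initial step size $\bar t>0$. For $k=0,1,\dots$: set the sampling radius $\Delta_k>0$; compute, from function values of $f$, an approximate gradient $g_k$ and an approximate Hessian $H_k$ of $f$ at $x_k$; solve $\min_d\, g_k^\top d+\frac12d^\top H_kd+h(x_k+d)$ inexactly to obtain $d_k$ for which there is a residual $r_k\in g_k+H_kd_k+\partial h(x_k+d_k)$ with $\|r_k\|_{H_k^{-1}}\le(1-\gamma)\|d_k\|_{H_k}$; if $\|d_k\|\le\epsilon$, stop; perform a backtracking line search (starting from $\bar t$ and reducing by the factor $\beta$) to obtain $t_k$ with $F(x_k+t_kd_k)-F(x_k)\le c_1t_k\Phi_k+nc_2\Delta_k^2$, where $\Phi_k:=g_k^\top d_k+h(x_k+d_k)-h(x_k)$; update $x_{k+1}=x_k+t_kd_k$.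 Output: $x_k+d_k$.
   Formalization: The formal theorem additionally assumes that the initial step size is at least the lower bound underline t (without this the claimed rate fails for very small initial steps), and that L_f > 0 so the constants are defined. *)

theory Defs
  imports "HOL-Analysis.Analysis"
begin

section \<open>Extended-real-valued convex functions\<close>

text \<open>
  Functions into \<open>\<real> \<union> {+\<infinity>}\<close> are rendered as \<^typ>\<open>ereal\<close>-valued functions; the value
  \<open>-\<infinity>\<close> is excluded by properness.
\<close>

definition proper_fun :: "('a \<Rightarrow> ereal) \<Rightarrow> bool" where
  "proper_fun h \<longleftrightarrow> (\<forall>x. h x \<noteq> -\<infinity>) \<and> (\<exists>x. h x \<noteq> \<infinity>)"

definition epi :: "('a \<Rightarrow> ereal) \<Rightarrow> ('a \<times> real) set" where
  "epi h = {(x, s). h x \<le> ereal s}"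

definition closed_fun :: "('a::topological_space \<Rightarrow> ereal) \<Rightarrow> bool" where
  "closed_fun h \<longleftrightarrow> closed (epi h)"

definition convex_fun :: "('a::real_vector \<Rightarrow> ereal) \<Rightarrow> bool" where
  "convex_fun h \<longleftrightarrow> convex (epi h)"

definition effective_domain :: "('a \<Rightarrow> ereal) \<Rightarrow> 'a set" where
  "effective_domain h = {x. h x < \<infinity>}"

definition subdifferential :: "('a::real_inner \<Rightarrow> ereal) \<Rightarrow> 'a \<Rightarrow> 'a set" where
  "subdifferential h x =
     {q. \<bar>h x\<bar> \<noteq> \<infinity> \<and> (\<forall>y. h x + ereal (q \<bullet> (y - x)) \<le> h y)}"

section \<open>The composite objective \<open>F = f + h\<close>\<close>

definition composite :: "('a \<Rightarrow> real) \<Rightarrow> ('a \<Rightarrow> ereal) \<Rightarrow> 'a \<Rightarrow> ereal" where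
  "composite f h x = ereal (f x) + h x"

definition composite_subdifferential ::
    "('a::real_inner \<Rightarrow> 'a) \<Rightarrow> ('a \<Rightarrow> ereal) \<Rightarrow> 'a \<Rightarrow> 'a set" where
  "composite_subdifferential gradf h x = (\<lambda>u. gradf x + u) ` subdifferential h x"

definition composite_strongly_convex ::
    "real \<Rightarrow> ('a::real_inner \<Rightarrow> real) \<Rightarrow> ('a \<Rightarrow> 'a) \<Rightarrow> ('a \<Rightarrow> ereal) \<Rightarrow> bool" where
  "composite_strongly_convex m f gradf h \<longleftrightarrow>
     (\<forall>x y. \<forall>q \<in> composite_subdifferential gradf h y.
        composite f h x \<ge> composite f h y + ereal (q \<bullet> (x - y) + m / 2 * (norm (x - y))\<^sup>2))"

section \<open>Matrices\<close>

text \<open>The Loewner order compares symmetric matrices only.\<close>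

definition loewner_le :: "real^'n^'n \<Rightarrow> real^'n^'n \<Rightarrow> bool" (infix "\<preceq>\<^sub>L" 50) where
  "A \<preceq>\<^sub>L B \<longleftrightarrow> transpose A = A \<and> transpose B = B \<and>
     (\<forall>v. v \<bullet> (A *v v) \<le> v \<bullet> (B *v v))"

definition weighted_norm :: "real^'n^'n \<Rightarrow> real^'n \<Rightarrow> real" where
  "weighted_norm A v = sqrt (v \<bullet> (A *v v))"

section \<open>Algorithm ZOPN\<close>

definition inexact_direction ::
    "(real^'n \<Rightarrow> ereal) \<Rightarrow> real \<Rightarrow> real^'n \<Rightarrow> real^'n^'n \<Rightarrow> real^'n \<Rightarrow> real^'n \<Rightarrow> bool" where
  "inexact_direction h \<gamma> g H x d \<longleftrightarrow>
     (\<exists>r. r \<in> (\<lambda>u. g + H *v d + u) ` subdifferential h (x + d) \<and>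
          weighted_norm (matrix_inv H) r \<le> (1 - \<gamma>) * weighted_norm H d)"

definition model_decrease ::
    "('a::real_inner \<Rightarrow> ereal) \<Rightarrow> 'a \<Rightarrow> 'a \<Rightarrow> 'a \<Rightarrow> ereal" where
  "model_decrease h g x d = ereal (g \<bullet> d) + h (x + d) - h x"

text \<open>
  The acceptance test for a trial step size \<open>s\<close>. Where \<open>h\<close> takes the value \<open>+\<infinity>\<close> at the trial
  point (and \<open>x\<close> is in the domain) the left-hand side is \<open>+\<infinity>\<close>, so the step is rejected.
\<close>

definition sufficient_decrease ::
    "(real^'n \<Rightarrow> real) \<Rightarrow> (real^'n \<Rightarrow> ereal) \<Rightarrow> real \<Rightarrow> real \<Rightarrow> real \<Rightarrow>
     real^'n \<Rightarrow> real^'n \<Rightarrow> real^'n \<Rightarrow> real \<Rightarrow> bool" where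
  "sufficient_decrease f h c1 c2 \<Delta> g x d s \<longleftrightarrow>
     composite f h (x + s *\<^sub>R d) - composite f h x
       \<le> ereal (c1 * s) * model_decrease h g x d + ereal (real CARD('n) * c2 * \<Delta>\<^sup>2)"

text \<open>Backtracking returns the first accepted step size among \<open>tbar, \<beta> tbar, \<beta>\<^sup>2 tbar, \<dots>\<close>.\<close>

definition backtracking_result :: "(real \<Rightarrow> bool) \<Rightarrow> real \<Rightarrow> real \<Rightarrow> real \<Rightarrow> bool" where
  "backtracking_result accept tbar \<beta> t \<longleftrightarrow>
     (\<exists>j. t = tbar * \<beta> ^ j \<and> accept t \<and> (\<forall>i<j. \<not> accept (tbar * \<beta> ^ i)))"

definition zopn_inputs ::
    "(real^'n \<Rightarrow> real) \<Rightarrow> (real^'n \<Rightarrow> ereal) \<Rightarrow> real^'n \<Rightarrow>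
     real \<Rightarrow> real \<Rightarrow> real \<Rightarrow> real \<Rightarrow> real \<Rightarrow> real \<Rightarrow> bool" where
  "zopn_inputs f h x0 \<epsilon> c1 c2 \<beta> \<gamma> tbar \<longleftrightarrow>
     x0 \<in> effective_domain (composite f h) \<and> 0 \<le> \<epsilon> \<and> 0 < c1 \<and> c1 < 1 / 2 \<and> 0 < c2 \<and>
     0 < \<beta> \<and> \<beta> < 1 \<and> 0 < \<gamma> \<and> \<gamma> \<le> 1 \<and> 0 < tbar"

text \<open>
  \<open>zopn_run f h \<epsilon> c1 c2 \<beta> \<gamma> tbar \<Delta> g H x d t T\<close>: started at \<open>x 0\<close>, the algorithm completes
  iterations \<open>0, \<dots>, T - 1\<close> without meeting its stopping test and thereby produces
  \<open>x 1, \<dots>, x T\<close>. The approximations \<open>g k\<close> and \<open>H k\<close> are arbitrary data here, because the algorithm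
  does not say how they are obtained from function values. Entries of the sequences that belong
  to later iterations are unconstrained.
\<close>

definition zopn_run ::
    "(real^'n \<Rightarrow> real) \<Rightarrow> (real^'n \<Rightarrow> ereal) \<Rightarrow>
     real \<Rightarrow> real \<Rightarrow> real \<Rightarrow> real \<Rightarrow> real \<Rightarrow> real \<Rightarrow>
     (nat \<Rightarrow> real) \<Rightarrow> (nat \<Rightarrow> real^'n) \<Rightarrow> (nat \<Rightarrow> real^'n^'n) \<Rightarrow>
     (nat \<Rightarrow> real^'n) \<Rightarrow> (nat \<Rightarrow> real^'n) \<Rightarrow> (nat \<Rightarrow> real) \<Rightarrow> nat \<Rightarrow> bool" where
  "zopn_run f h \<epsilon> c1 c2 \<beta> \<gamma> tbar \<Delta> g H x d t T \<longleftrightarrow>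
     zopn_inputs f h (x 0) \<epsilon> c1 c2 \<beta> \<gamma> tbar \<and>
     (\<forall>k<T. 0 < \<Delta> k \<and>
        inexact_direction h \<gamma> (g k) (H k) (x k) (d k) \<and>
        \<not> norm (d k) \<le> \<epsilon> \<and>
        backtracking_result (sufficient_decrease f h c1 c2 (\<Delta> k) (g k) (x k) (d k)) tbar \<beta> (t k) \<and>
        x (Suc k) = x k + t k *\<^sub>R d k)"

end

theory Submission
  imports Defs
begin

text \<open>
  Write \<open>\<Phi>\<close> for the model decrease of an iteration, \<open>\<delta>\<close> for the optimality gap \<open>F(x) - F(z)\<close> at its
  starting point \<open>x\<close>, where \<open>z\<close> is the minimizer, and \<open>p = \<kappa>lo \<gamma>\<close>. The linear rate comes from four
  estimates.

  \<^item> The residual criterion supplies a subgradient \<open>u \<in> \<partial>h(x + d)\<close> with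
    \<open>(g + u) \<bullet> d \<le> - p \<parallel>d\<parallel>\<^sup>2\<close> and \<open>\<parallel>g + u\<parallel> \<le> 2 \<kappa>up \<parallel>d\<parallel>\<close> (\<open>inexact_direction_subgradient\<close>).
    In particular \<open>\<Phi> \<le> - p \<parallel>d\<parallel>\<^sup>2\<close>.

  \<^item> All steps up to \<open>tlow / \<beta>\<close> pass the acceptance test (\<open>short_step_decrease\<close>), so that the
    backtracking step is at least \<open>tlow\<close> and the objective changes by at most
    \<open>c1 tlow \<Phi> + n c2 \<Delta>\<^sup>2\<close>.

  \<^item> Convexity of \<open>f\<close>, the subgradient \<open>u\<close> and quadratic growth of \<open>F\<close> around \<open>z\<close> bound \<open>\<Phi>\<close> from
    above by a negative multiple of \<open>\<delta>\<close>, up to the squared gradient error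
    (\<open>model_decrease_controls_gap\<close>).

  \<^item> Together these give \<open>\<delta>' \<le> \<tau> \<delta> + (n c2 + \<omega> \<kappa>eg\<^sup>2) \<Delta>\<^sup>2\<close> for the gap \<open>\<delta>'\<close> after the iteration
    (\<open>zopn_iteration_contraction\<close>), and this recurrence is unrolled (\<open>linear_recurrence_bound\<close>).

  Strong convexity is only postulated at points where \<open>\<partial>F\<close> is nonempty. The first direction of the
  algorithm yields such a point, and one such point suffices for the existence of a minimizer
  (\<open>strongly_convex_has_minimizer\<close>). Since \<open>0 \<in> \<partial>F(z)\<close> at every minimizer \<open>z\<close>, quadratic growth
  around \<open>z\<close> and uniqueness follow.
\<close>

section \<open>First-order and convexity inequalities along segments\<close>

lemma GDERIV_along_line:
  fixes f :: "'a::real_inner \<Rightarrow> real"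
  assumes "GDERIV f (x + s *\<^sub>R v) :> D"
  shows "((\<lambda>s. f (x + s *\<^sub>R v)) has_real_derivative (D \<bullet> v)) (at s)"
proof -
  have 1: "((\<lambda>s. x + s *\<^sub>R v) has_derivative (\<lambda>r. r *\<^sub>R v)) (at s)"
    by (auto intro!: derivative_eq_intros)
  have 2: "(f has_derivative (\<lambda>w. w \<bullet> D)) (at (x + s *\<^sub>R v))"
    using assms by (simp add: gderiv_def)
  have "((\<lambda>s. f (x + s *\<^sub>R v)) has_derivative (\<lambda>r. (r *\<^sub>R v) \<bullet> D)) (at s)"
    by (rule has_derivative_compose[OF 1 2])
  moreover have "(\<lambda>r. (r *\<^sub>R v) \<bullet> D) = (*) (D \<bullet> v)"
    by (auto simp: inner_commute)
  ultimately show ?thesis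
    by (simp add: has_field_derivative_def)
qed

lemma lipschitz_gradient_upper_bound:
  fixes f :: "'a::real_inner \<Rightarrow> real"
  assumes grad: "\<And>y. GDERIV f y :> gradf y" and lip: "L-lipschitz_on UNIV gradf"
  shows "f (x + v) \<le> f x + gradf x \<bullet> v + L / 2 * (norm v)\<^sup>2"
proof -
  let ?\<phi> = "\<lambda>s. f (x + s *\<^sub>R v) - s * (gradf x \<bullet> v) - L / 2 * s\<^sup>2 * (norm v)\<^sup>2"
  have "?\<phi> 1 \<le> ?\<phi> 0"
  proof (rule DERIV_nonpos_imp_nonincreasing[OF zero_le_one])
    fix s :: real
    assume s: "0 \<le> s" "s \<le> 1"
    have "(?\<phi> has_real_derivative
        (gradf (x + s *\<^sub>R v) \<bullet> v - gradf x \<bullet> v - L * s * (norm v)\<^sup>2)) (at s)"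
      by (auto intro!: derivative_eq_intros GDERIV_along_line[OF grad])
    moreover have "gradf (x + s *\<^sub>R v) \<bullet> v - gradf x \<bullet> v - L * s * (norm v)\<^sup>2 \<le> 0"
    proof -
      have "gradf (x + s *\<^sub>R v) \<bullet> v - gradf x \<bullet> v
          \<le> norm (gradf (x + s *\<^sub>R v) - gradf x) * norm v"
        by (metis inner_diff_left norm_cauchy_schwarz)
      also have "\<dots> \<le> (L * norm (s *\<^sub>R v)) * norm v"
        using lipschitz_onD[OF lip, of "x + s *\<^sub>R v" x]
        by (intro mult_right_mono) (auto simp: dist_norm)
      also have "\<dots> = L * s * (norm v)\<^sup>2"
        using s by (simp add: power2_eq_square)
      finally show ?thesis by simp
    qed
    ultimately show "\<exists>y. (?\<phi> has_real_derivative y) (at s) \<and> y \<le> 0"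
      by blast
  qed
  then show ?thesis by simp
qed

lemma convex_on_gradient_lower_bound:
  fixes f :: "'a::real_inner \<Rightarrow> real"
  assumes grad: "GDERIV f x :> D" and conv: "convex_on UNIV f"
  shows "f x + D \<bullet> (y - x) \<le> f y"
proof -
  let ?\<phi> = "\<lambda>s. f (x + s *\<^sub>R (y - x))"
  have "convex_on UNIV ?\<phi>"
  proof (rule convex_onI)
    fix u a b :: real
    assume u: "0 < u" "u < 1"
    have "x + ((1 - u) *\<^sub>R a + u *\<^sub>R b) *\<^sub>R (y - x)
        = (1 - u) *\<^sub>R (x + a *\<^sub>R (y - x)) + u *\<^sub>R (x + b *\<^sub>R (y - x))"
      by (simp add: algebra_simps)
    then show "?\<phi> ((1 - u) *\<^sub>R a + u *\<^sub>R b) \<le> (1 - u) * ?\<phi> a + u * ?\<phi> b"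
      using convex_onD[OF conv, of u] u by simp
  qed simp
  moreover have "(?\<phi> has_real_derivative (D \<bullet> (y - x))) (at 0)"
    using grad by (intro GDERIV_along_line) simp
  ultimately have "?\<phi> 1 - ?\<phi> 0 \<ge> D \<bullet> (y - x) * (1 - 0)"
    by (intro convex_on_imp_above_tangent[where A = UNIV]) auto
  then show ?thesis by simp
qed

lemma convex_fun_segment:
  assumes "convex_fun h" and "h x \<le> ereal a" and "h (x + v) \<le> ereal b" and "0 \<le> s" "s \<le> 1"
  shows "h (x + s *\<^sub>R v) \<le> ereal (a + s * (b - a))"
proof -
  have "(1 - s) *\<^sub>R (x, a) + s *\<^sub>R (x + v, b) \<in> epi h"
    using assms by (intro convexD) (auto simp: convex_fun_def epi_def)
  moreover have "(1 - s) *\<^sub>R (x, a) + s *\<^sub>R (x + v, b) = (x + s *\<^sub>R v, a + s * (b - a))"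
    by (simp add: algebra_simps)
  ultimately show ?thesis by (simp add: epi_def)
qed

section \<open>Minimizers of the composite objective\<close>

text \<open>
  The first-order optimality condition \<open>0 \<in> \<partial>F(z)\<close>. Along a segment towards a point of the domain,
  \<open>f\<close> exceeds its linearization by at most a quadratic term, so a negative directional derivative
  would contradict minimality for short steps.
\<close>

lemma minimizer_zero_subgradient:
  fixes f :: "'a::real_inner \<Rightarrow> real"
  assumes grad: "\<And>y. GDERIV f y :> gradf y" and lip: "L-lipschitz_on UNIV gradf"
    and h: "proper_fun h" "convex_fun h"
    and min: "\<And>y. composite f h z \<le> composite f h y"
  shows "0 \<in> composite_subdifferential gradf h z"
proof -
  obtain y0 where y0: "h y0 \<noteq> \<infinity>" using h(1) by (auto simp: proper_fun_def)
  have notm: "h y \<noteq> -\<infinity>" for y using h(1) by (auto simp: proper_fun_def)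
  have "h z \<noteq> \<infinity>"
    using min[of y0] y0 notm[of y0] by (cases "h y0") (auto simp: composite_def)
  then obtain a where a: "h z = ereal a" using notm[of z] by (cases "h z") auto
  have "h z + ereal (- gradf z \<bullet> (y - z)) \<le> h y" for y
  proof (cases "h y")
    case (real b)
    let ?v = "y - z"
    let ?A = "gradf z \<bullet> ?v + (b - a)" and ?B = "L / 2 * (norm ?v)\<^sup>2"
    have B0: "0 \<le> ?B" using lipschitz_on_nonneg[OF lip] by simp
    have AB: "0 \<le> ?A + s * ?B" if s: "0 < s" "s \<le> 1" for s
    proof -
      have "h (z + s *\<^sub>R ?v) \<le> ereal (a + s * (b - a))"
        using s a real by (intro convex_fun_segment[OF h(2)]) auto
      then have "composite f h (z + s *\<^sub>R ?v) \<le> ereal (f (z + s *\<^sub>R ?v) + (a + s * (b - a)))"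
        using add_left_mono[of _ _ "ereal (f (z + s *\<^sub>R ?v))"] by (fastforce simp: composite_def)
      then have "ereal (f z + a) \<le> ereal (f (z + s *\<^sub>R ?v) + (a + s * (b - a)))"
        using order_trans[OF min[of "z + s *\<^sub>R ?v"]] a
        by (metis composite_def plus_ereal.simps(1))
      moreover have "f (z + s *\<^sub>R ?v) \<le> f z + s * (gradf z \<bullet> ?v) + s\<^sup>2 * ?B"
        using lipschitz_gradient_upper_bound[OF grad lip, of z "s *\<^sub>R ?v"]
        by (simp add: power_mult_distrib mult_ac)
      ultimately have "0 \<le> s * (?A + s * ?B)"
        by (simp add: algebra_simps power2_eq_square)
      then show ?thesis using s by (simp add: zero_le_mult_iff)
    qed
    have "0 \<le> ?A"
    proof (rule field_le_epsilon)
      fix e :: real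
      assume e: "0 < e"
      let ?s = "min 1 (e / (?B + 1))"
      have "?s * ?B \<le> e / (?B + 1) * (?B + 1)"
        using B0 e by (intro mult_mono) auto
      also have "\<dots> = e" using B0 by simp
      finally show "0 \<le> ?A + e"
        using AB[of ?s] B0 e by (simp add: field_simps)
    qed
    then show ?thesis using a real by (simp add: algebra_simps)
  qed (use notm[of y] in auto)
  then have "- gradf z \<in> subdifferential h z"
    using a by (auto simp: subdifferential_def)
  then show ?thesis
    by (force simp: composite_subdifferential_def)
qed

lemma strongly_convex_quadratic_growth:
  assumes "composite_strongly_convex m f gradf h"
    and "0 \<in> composite_subdifferential gradf h z"
  shows "composite f h z + ereal (m / 2 * (norm (y - z))\<^sup>2) \<le> composite f h y"
  using assms unfolding composite_strongly_convex_def by fastforce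

text \<open>
  Existence of a minimizer. A single subgradient at \<open>y0\<close> already confines the sublevel set of
  \<open>F(y0)\<close> to a ball, and the minimum of the continuous map \<open>(y, s) \<mapsto> f y + s\<close> is attained on the
  relevant compact piece of the closed epigraph of \<open>h\<close>.
\<close>

lemma strongly_convex_has_minimizer:
  fixes f :: "'a::euclidean_space \<Rightarrow> real"
  assumes contf: "continuous_on UNIV f" and h: "proper_fun h" "closed_fun h"
    and sc: "composite_strongly_convex m f gradf h" and m: "0 < m"
    and q: "q \<in> composite_subdifferential gradf h y0"
  shows "\<exists>z. \<forall>y. composite f h z \<le> composite f h y"
proof -
  have notm: "h y \<noteq> -\<infinity>" for y using h(1) by (auto simp: proper_fun_def)
  obtain a where a: "h y0 = ereal a"
    using q by (auto simp: composite_subdifferential_def subdifferential_def)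
  define F0 where "F0 = f y0 + a"
  define R where "R = 2 * norm q / m"
  have grow: "F0 + q \<bullet> (y - y0) + m / 2 * (norm (y - y0))\<^sup>2 \<le> f y + b" if "h y = ereal b" for y b
  proof -
    have "composite f h y \<ge> composite f h y0 + ereal (q \<bullet> (y - y0) + m / 2 * (norm (y - y0))\<^sup>2)"
      using sc q unfolding composite_strongly_convex_def by blast
    then show ?thesis using a that by (simp add: composite_def F0_def)
  qed
  have ball: "y \<in> cball y0 R" if y: "h y = ereal b" "f y + b \<le> F0" for y b
  proof -
    let ?r = "norm (y - y0)"
    have "m / 2 * ?r\<^sup>2 \<le> - (q \<bullet> (y - y0))" using grow[OF y(1)] y(2) by simp
    also have "\<dots> \<le> norm q * ?r"
      using norm_cauchy_schwarz[of "- q" "y - y0"] by simp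
    finally have "?r * (m * ?r) \<le> ?r * (2 * norm q)" by (simp add: power2_eq_square algebra_simps)
    then have "m * ?r \<le> 2 * norm q"
      by (cases "?r = 0") (auto simp: mult_le_cancel_left)
    then show ?thesis
      using m by (simp add: R_def dist_norm norm_minus_commute field_simps)
  qed
  have "compact (f ` cball y0 R)"
    by (intro compact_continuous_image continuous_on_subset[OF contf]) auto
  then obtain M where M: "\<And>y. y \<in> cball y0 R \<Longrightarrow> \<bar>f y\<bar> \<le> M"
    by (meson bounded_real compact_imp_bounded imageI)
  define lo where "lo = F0 - norm q * R - M"
  define up where "up = F0 + M"
  define K where "K = epi h \<inter> (cball y0 R \<times> {lo..up})"
  have inK: "(y, b) \<in> K" if y: "h y = ereal b" "f y + b \<le> F0" for y b
  proof -
    have yb: "y \<in> cball y0 R" by (rule ball[OF y])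
    have "- (norm q * R) \<le> - (norm q * norm (y - y0))"
      using yb by (simp add: dist_norm norm_minus_commute mult_left_mono)
    also have "\<dots> \<le> q \<bullet> (y - y0)"
      using norm_cauchy_schwarz[of "- q" "y - y0"] by simp
    also have "\<dots> \<le> f y + b - F0" using grow[OF y(1)] m
      by (smt (verit) divide_nonneg_nonneg mult_nonneg_nonneg zero_le_power2)
    finally show ?thesis
      using M[OF yb] y yb by (auto simp: K_def epi_def lo_def up_def)
  qed
  have y0K: "(y0, a) \<in> K" using inK[of y0 a] a by (simp add: F0_def)
  have "compact K"
    using h(2) unfolding K_def closed_fun_def
    by (intro closed_Int_compact compact_Times) auto
  moreover have "continuous_on K (\<lambda>p. f (fst p) + snd p)"
    by (intro continuous_intros continuous_on_compose2[OF contf]) auto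
  ultimately obtain p where p: "p \<in> K" "\<And>p'. p' \<in> K \<Longrightarrow> f (fst p) + snd p \<le> f (fst p') + snd p'"
    using continuous_attains_inf[of K "\<lambda>p. f (fst p) + snd p"] y0K by blast
  have Fp: "composite f h (fst p) \<le> ereal (f (fst p) + snd p)"
    using p(1) add_left_mono[of "h (fst p)" "ereal (snd p)" "ereal (f (fst p))"]
    by (auto simp: K_def epi_def composite_def)
  have "composite f h (fst p) \<le> composite f h y" for y
  proof (cases "h y")
    case (real b)
    have "f (fst p) + snd p \<le> f y + b"
    proof (cases "f y + b \<le> F0")
      case True
      then show ?thesis using p(2)[OF inK[OF real]] by simp
    next
      case False
      then show ?thesis using p(2)[OF y0K] by (simp add: F0_def)
    qed
    then have "ereal (f (fst p) + snd p) \<le> composite f h y"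
      using real by (simp add: composite_def)
    with Fp show ?thesis by (rule order_trans)
  qed (use notm[of y] in \<open>auto simp: composite_def\<close>)
  then show ?thesis by blast
qed

section \<open>Norms weighted by a positive definite matrix\<close>

lemma loewner_bounds:
  assumes "mat lo \<preceq>\<^sub>L H" and "H \<preceq>\<^sub>L mat up"
  shows "transpose H = H" and "lo * (norm v)\<^sup>2 \<le> v \<bullet> (H *v v)"
    and "v \<bullet> (H *v v) \<le> up * (norm v)\<^sup>2"
proof -
  have mat: "mat c *v v = c *\<^sub>R v" for c :: real and v :: "real^'a"
    by (simp add: vec_eq_iff matrix_vector_mult_def mat_def if_distrib[of "\<lambda>x. x * _"] cong: if_cong)
  show "transpose H = H" using assms by (simp add: loewner_le_def)
  show "lo * (norm v)\<^sup>2 \<le> v \<bullet> (H *v v)" "v \<bullet> (H *v v) \<le> up * (norm v)\<^sup>2"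
    using assms unfolding loewner_le_def mat power2_norm_eq_inner by (metis inner_scaleR_right)+
qed

lemma symmetric_matrix_inner:
  fixes H :: "real^'n^'n"
  assumes "transpose H = H"
  shows "(H *v u) \<bullet> v = u \<bullet> (H *v v)"
  by (metis assms dot_lmul_matrix vector_transpose_matrix)

lemma weighted_cauchy_schwarz:
  fixes H :: "real^'n^'n"
  assumes sym: "transpose H = H" and pos: "\<And>v. v \<noteq> 0 \<Longrightarrow> 0 < v \<bullet> (H *v v)"
  shows "u \<bullet> (H *v v) \<le> weighted_norm H u * weighted_norm H v"
proof (cases "v = 0")
  case False
  let ?b = "u \<bullet> (H *v v)" and ?q = "v \<bullet> (H *v v)"
  have q: "0 < ?q" by (rule pos[OF False])
  let ?w = "u - (?b / ?q) *\<^sub>R v"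
  have vu: "v \<bullet> (H *v u) = ?b"
    by (metis inner_commute symmetric_matrix_inner[OF sym])
  have "0 \<le> ?w \<bullet> (H *v ?w)"
    using pos[of ?w] by (cases "?w = 0") auto
  also have "\<dots> = u \<bullet> (H *v u) - ?b\<^sup>2 / ?q"
    using q vu by (simp add: matrix_vector_mult_diff_distrib matrix_vector_mult_scaleR
        inner_diff_left inner_diff_right power2_eq_square)
  finally have "?b\<^sup>2 \<le> (u \<bullet> (H *v u)) * ?q"
    using q by (simp add: field_simps)
  then show ?thesis
    unfolding weighted_norm_def real_sqrt_mult[symmetric] by (rule real_le_rsqrt)
qed (simp add: weighted_norm_def)

lemma weighted_norm_square:
  assumes "0 \<le> v \<bullet> (A *v v)"
  shows "(weighted_norm A v)\<^sup>2 = v \<bullet> (A *v v)"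
  using assms by (simp add: weighted_norm_def)

text \<open>
  The weighted Cauchy-Schwarz inequality for the pair \<open>w\<close>, \<open>H w\<close> bounds \<open>\<parallel>H w\<parallel>\<^sup>2\<close>; this saves a factor
  \<open>sqrt (\<kappa> / lo)\<close>, for \<open>lo\<close> a lower eigenvalue bound of \<open>H\<close>, over bounding \<open>\<parallel>w\<parallel>\<close> separately.
\<close>

lemma norm_matrix_vector_le_weighted_norm:
  fixes H :: "real^'n^'n"
  assumes sym: "transpose H = H" and pos: "\<And>v. v \<noteq> 0 \<Longrightarrow> 0 < v \<bullet> (H *v v)"
    and up: "\<And>v. v \<bullet> (H *v v) \<le> \<kappa> * (norm v)\<^sup>2"
  shows "norm (H *v w) \<le> sqrt \<kappa> * weighted_norm H w"
proof (cases "H *v w = 0")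
  case True
  have "0 \<le> \<kappa>"
    using up[of "axis undefined 1"] pos[of "axis undefined 1"]
    by (simp add: axis_eq_0_iff)
  have "w \<bullet> (H *v w) \<ge> 0" using pos[of w] by (cases "w = 0") auto
  then show ?thesis using True \<open>0 \<le> \<kappa>\<close> by (simp add: weighted_norm_def)
next
  case False
  let ?z = "H *v w"
  have "(norm ?z)\<^sup>2 = w \<bullet> (H *v ?z)"
    by (simp add: power2_norm_eq_inner symmetric_matrix_inner[OF sym])
  also have "\<dots> \<le> weighted_norm H w * weighted_norm H ?z"
    by (rule weighted_cauchy_schwarz[OF sym pos])
  also have "\<dots> \<le> weighted_norm H w * (sqrt \<kappa> * norm ?z)"
  proof (rule mult_left_mono)
    show "weighted_norm H ?z \<le> sqrt \<kappa> * norm ?z"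
      using real_sqrt_le_mono[OF up[of ?z]] by (simp add: weighted_norm_def real_sqrt_mult)
    show "0 \<le> weighted_norm H w"
      using pos[of w] by (cases "w = 0") (auto simp: weighted_norm_def)
  qed
  finally have "norm ?z * norm ?z \<le> (sqrt \<kappa> * weighted_norm H w) * norm ?z"
    by (simp add: power2_eq_square algebra_simps)
  then show ?thesis using False by (simp add: mult_le_cancel_right)
qed

lemma matrix_mul_matrix_inv:
  fixes A :: "'a::semiring_1^'n^'m"
  assumes "invertible A"
  shows "A ** matrix_inv A = mat 1"
  unfolding matrix_inv_def by (rule someI2_ex) (use assms in \<open>auto simp: invertible_def\<close>)

section \<open>The inexact Newton direction\<close>

text \<open>
  With \<open>r = g + H d + u\<close> the residual and \<open>w = H\<inverse> r\<close>, the inexactness criterion compares the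
  \<open>H\<close>-norms of \<open>w\<close> and \<open>d\<close>, because \<open>\<parallel>r\<parallel>\<close> in the \<open>H\<inverse>\<close>-norm is \<open>\<parallel>w\<parallel>\<close> in the \<open>H\<close>-norm. Moreover
  \<open>g + u = H (w - d)\<close>.
\<close>

lemma inexact_direction_subgradient:
  fixes H :: "real^'n^'n"
  assumes bounds: "mat lo \<preceq>\<^sub>L H" "H \<preceq>\<^sub>L mat up" and lo: "0 < lo"
    and \<gamma>: "0 < \<gamma>" "\<gamma> \<le> 1"
    and dir: "inexact_direction h \<gamma> g H x d"
  obtains u where "u \<in> subdifferential h (x + d)"
    and "(g + u) \<bullet> d \<le> - (lo * \<gamma> * (norm d)\<^sup>2)"
    and "norm (g + u) \<le> 2 * up * norm d"
proof -
  note sym = loewner_bounds(1)[OF bounds] and ge = loewner_bounds(2)[OF bounds]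
    and le = loewner_bounds(3)[OF bounds]
  have pos: "0 < v \<bullet> (H *v v)" if "v \<noteq> 0" for v
  proof -
    have "0 < lo * (norm v)\<^sup>2" using lo that by simp
    then show ?thesis using ge[of v] by linarith
  qed
  have nonneg: "0 \<le> v \<bullet> (H *v v)" for v using pos[of v] by (cases "v = 0") auto
  obtain u where u: "u \<in> subdifferential h (x + d)"
    and res: "weighted_norm (matrix_inv H) (g + H *v d + u) \<le> (1 - \<gamma>) * weighted_norm H d"
    using dir by (auto simp: inexact_direction_def)
  define w where "w = matrix_inv H *v (g + H *v d + u)"
  have "v = 0" if "H *v v = 0" for v using pos[of v] that by force
  then have "invertible H"
    by (simp add: invertible_left_inverse matrix_left_invertible_ker)
  then have Hw: "H *v w = g + H *v d + u"
    unfolding w_def by (simp add: matrix_vector_mul_assoc matrix_mul_matrix_inv)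
  have "(g + H *v d + u) \<bullet> w = w \<bullet> (H *v w)"
    by (simp add: Hw inner_commute)
  then have wd: "weighted_norm H w \<le> (1 - \<gamma>) * weighted_norm H d"
    using res by (simp add: weighted_norm_def w_def)
  have dn: "0 \<le> weighted_norm H d" using nonneg by (simp add: weighted_norm_def)
  have gu: "g + u = H *v (w - d)"
    by (simp add: matrix_vector_mult_diff_distrib Hw)
  have "(g + u) \<bullet> d = w \<bullet> (H *v d) - d \<bullet> (H *v d)"
    by (simp add: gu symmetric_matrix_inner[OF sym] inner_diff_left)
  also have "\<dots> \<le> weighted_norm H w * weighted_norm H d - (weighted_norm H d)\<^sup>2"
    using weighted_cauchy_schwarz[OF sym pos, of w d] weighted_norm_square[OF nonneg, of d] by simp
  also have "\<dots> \<le> ((1 - \<gamma>) * weighted_norm H d) * weighted_norm H d - (weighted_norm H d)\<^sup>2"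
    using wd dn by (simp add: mult_right_mono)
  also have "\<dots> = - \<gamma> * (d \<bullet> (H *v d))"
    using weighted_norm_square[OF nonneg, of d] by (simp add: algebra_simps power2_eq_square)
  also have "\<dots> \<le> - \<gamma> * (lo * (norm d)\<^sup>2)"
    using ge[of d] \<gamma> by (simp add: mult_left_mono)
  finally have descent: "(g + u) \<bullet> d \<le> - (lo * \<gamma> * (norm d)\<^sup>2)" by (simp add: mult_ac)
  have up: "0 \<le> up"
    using le[of "axis undefined 1"] nonneg[of "axis undefined 1"] by (simp add: norm_axis_1)
  have "norm (g + u) \<le> norm (H *v w) + norm (H *v d)"
    by (simp add: gu matrix_vector_mult_diff_distrib norm_triangle_ineq4)
  also have "\<dots> \<le> sqrt up * weighted_norm H w + sqrt up * weighted_norm H d"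
    by (intro add_mono norm_matrix_vector_le_weighted_norm[OF sym pos le])
  also have "\<dots> \<le> sqrt up * weighted_norm H d + sqrt up * weighted_norm H d"
  proof -
    have "weighted_norm H w \<le> weighted_norm H d"
      using wd \<gamma> dn mult_left_le_one_le[OF dn, of "1 - \<gamma>"] by linarith
    then show ?thesis using up by (simp add: mult_left_mono)
  qed
  also have "\<dots> \<le> 2 * (sqrt up * (sqrt up * norm d))"
  proof -
    have "weighted_norm H d \<le> sqrt up * norm d"
      using real_sqrt_le_mono[OF le[of d]] by (simp add: weighted_norm_def real_sqrt_mult)
    then show ?thesis using up by (simp add: mult_left_mono)
  qed
  also have "\<dots> = 2 * up * norm d"
    using up by (simp add: mult.assoc[symmetric])
  finally show thesis using that u descent by blast
qed

lemma subgradient_bound: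
  assumes "u \<in> subdifferential h y" "h y = ereal b" "h z = ereal c"
  shows "b - c \<le> u \<bullet> (y - z)"
proof -
  have "ereal b + ereal (u \<bullet> (z - y)) \<le> ereal c"
    using assms unfolding subdifferential_def by (metis (mono_tags, lifting) mem_Collect_eq)
  then show ?thesis by (simp add: inner_diff_right)
qed

section \<open>Step sizes of the line search\<close>

text \<open>
  A step \<open>s\<close> lowers the model \<open>s \<mapsto> s (g \<bullet> d) + h(x + s d)\<close> by at least \<open>- s \<Phi>\<close>, where
  \<open>\<Phi> = g \<bullet> d + b - a\<close>. The test claims the fraction \<open>c1\<close> of this, and the rest, at least \<open>(1 - c1) s p \<parallel>d\<parallel>\<^sup>2\<close>, pays for the errors: the bound
  on \<open>L * s\<close> limits the curvature term of \<open>f\<close> to \<open>(1/2 - c1) s p \<parallel>d\<parallel>\<^sup>2\<close>, and the remaining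
  \<open>s p \<parallel>d\<parallel>\<^sup>2 / 2\<close> covers the gradient error up to \<open>N\<close>, by Young's inequality and the bound on
  \<open>s * e\<^sup>2\<close>.
\<close>

lemma short_step_decrease:
  fixes f :: "'a::real_inner \<Rightarrow> real"
  assumes grad: "\<And>y. GDERIV f y :> gradf y" and lip: "L-lipschitz_on UNIV gradf"
    and conv: "convex_fun h"
    and vals: "h x = ereal a" "h (x + d) = ereal b"
    and model: "g \<bullet> d + b - a \<le> - (p * (norm d)\<^sup>2)" and p: "0 < p"
    and err: "norm (g - gradf x) \<le> e"
    and c1: "c1 \<le> 1"
    and s: "0 < s" "s \<le> 1" "L * s \<le> p * (1 - 2 * c1)" "s * e\<^sup>2 \<le> 2 * p * N"
  shows "composite f h (x + s *\<^sub>R d) \<le> ereal (f x + a + c1 * s * (g \<bullet> d + b - a) + N)"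
proof -
  define \<Phi> where "\<Phi> = g \<bullet> d + b - a"
  define r where "r = norm d"
  have hs: "h (x + s *\<^sub>R d) \<le> ereal (a + s * (b - a))"
    using s vals by (intro convex_fun_segment[OF conv]) auto
  have fs: "f (x + s *\<^sub>R d) \<le> f x + s * (gradf x \<bullet> d) + L / 2 * (s * r)\<^sup>2"
    using lipschitz_gradient_upper_bound[OF grad lip, of x "s *\<^sub>R d"] s
    by (simp add: power_mult_distrib r_def)
  have "gradf x \<bullet> d - g \<bullet> d \<le> norm (gradf x - g) * r"
    unfolding r_def by (metis inner_diff_left norm_cauchy_schwarz)
  also have "\<dots> \<le> e * r"
    using err by (intro mult_right_mono) (auto simp: norm_minus_commute r_def)
  finally have ge: "s * (gradf x \<bullet> d) \<le> s * (g \<bullet> d) + s * (e * r)"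
    using s(1) by (simp add: distrib_left[symmetric])
  have curv: "L / 2 * (s * r)\<^sup>2 \<le> s * r\<^sup>2 * (p * (1 - 2 * c1)) / 2"
  proof -
    have "s * r\<^sup>2 * (L * s) \<le> s * r\<^sup>2 * (p * (1 - 2 * c1))"
      using s by (intro mult_left_mono) auto
    then show ?thesis by (simp add: power2_eq_square algebra_simps)
  qed
  have young: "s * (e * r) \<le> p * (s * r\<^sup>2) / 2 + N"
  proof -
    have "0 \<le> (p * r - e)\<^sup>2" by simp
    then have "2 * p * (e * r) \<le> p\<^sup>2 * r\<^sup>2 + e\<^sup>2" by (simp add: power2_eq_square algebra_simps)
    then have "s * (2 * p * (e * r)) \<le> s * (p\<^sup>2 * r\<^sup>2 + e\<^sup>2)"
      using s(1) by (intro mult_left_mono) auto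
    then have "2 * p * (s * (e * r)) \<le> 2 * p * (p * (s * r\<^sup>2) / 2 + N)"
      using s(4) by (simp add: power2_eq_square algebra_simps)
    then show ?thesis using p by simp
  qed
  have "(1 - c1) * s * \<Phi> \<le> (1 - c1) * s * (- (p * r\<^sup>2))"
    using model c1 s by (intro mult_left_mono) (auto simp: \<Phi>_def r_def)
  then have "f (x + s *\<^sub>R d) + (a + s * (b - a)) \<le> f x + a + c1 * s * \<Phi> + N"
    using fs ge curv young by (simp add: \<Phi>_def algebra_simps)
  then have "ereal (f (x + s *\<^sub>R d)) + ereal (a + s * (b - a)) \<le> ereal (f x + a + c1 * s * \<Phi> + N)"
    by simp
  then show ?thesis
    using order_trans[OF add_left_mono[OF hs]] by (simp add: composite_def \<Phi>_def)
qed

lemma backtracking_result_lower_bound: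
  assumes res: "backtracking_result accept tbar \<beta> t" and \<beta>: "0 < \<beta>" and tbar: "0 < tbar"
    and short: "\<And>s. 0 < s \<Longrightarrow> s \<le> smax \<Longrightarrow> accept s"
    and ge: "\<beta> * smax \<le> tbar"
  shows "\<beta> * smax \<le> t"
proof -
  obtain j where j: "t = tbar * \<beta> ^ j" "\<And>i. i < j \<Longrightarrow> \<not> accept (tbar * \<beta> ^ i)"
    using res by (auto simp: backtracking_result_def)
  show ?thesis
  proof (cases j)
    case 0
    then show ?thesis using j(1) ge by simp
  next
    case (Suc i)
    then have "smax < tbar * \<beta> ^ i"
      using j(2)[of i] short[of "tbar * \<beta> ^ i"] \<beta> tbar by fastforce
    then show ?thesis using j(1) Suc \<beta> by (simp add: mult.left_commute)
  qed
qed

section \<open>Linear contraction of the optimality gap\<close>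

text \<open>
  The model decrease controls the optimality gap \<open>\<delta>\<close>. Comparing with the minimizer \<open>z\<close> through the
  subgradient at \<open>x + d\<close> and the convexity of \<open>f\<close> gives \<open>\<Phi> \<le> - \<delta> + (e + 2 \<kappa> \<parallel>d\<parallel>) \<parallel>x - z\<parallel>\<close>.
  Quadratic growth bounds \<open>\<parallel>x - z\<parallel>\<^sup>2\<close> by \<open>2 \<delta> / m\<close>, so by Young's inequality half of \<open>\<delta>\<close>
  absorbs the factors \<open>\<parallel>x - z\<parallel>\<close>, and the resulting multiple of \<open>\<parallel>d\<parallel>\<^sup>2\<close> is at most a multiple of
  \<open>- \<Phi>\<close>.
\<close>

lemma model_decrease_controls_gap:
  fixes f :: "'a::real_inner \<Rightarrow> real"
  assumes grad: "\<And>y. GDERIV f y :> gradf y" and fconv: "convex_on UNIV f" and m: "0 < m"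
    and vals: "h x = ereal a" "h (x + d) = ereal b" "h z = ereal c"
    and growth: "m / 2 * (norm (x - z))\<^sup>2 \<le> f x + a - (f z + c)"
    and u: "u \<in> subdifferential h (x + d)"
    and descent: "(g + u) \<bullet> d \<le> - (p * (norm d)\<^sup>2)" and p: "0 < p"
    and bnd: "norm (g + u) \<le> 2 * \<kappa> * norm d"
    and err: "norm (g - gradf x) \<le> e"
  shows "(2 * p + 16 * \<kappa>\<^sup>2 / m) * (g \<bullet> d + b - a)
    \<le> - p * (f x + a - (f z + c)) + 4 * p / m * e\<^sup>2"
proof -
  define \<Phi> where "\<Phi> = g \<bullet> d + b - a"
  define \<delta> where "\<delta> = f x + a - (f z + c)"
  define r where "r = norm d"
  define R where "R = norm (x - z)"
  have young: "\<alpha> * R \<le> \<delta> / 4 + 2 / m * \<alpha>\<^sup>2" for \<alpha>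
  proof -
    have "0 \<le> (m * R - 4 * \<alpha>)\<^sup>2 / (8 * m)" using m by simp
    also have "\<dots> = m / 8 * R\<^sup>2 - \<alpha> * R + 2 / m * \<alpha>\<^sup>2"
      using m by (simp add: power2_eq_square field_simps)
    finally have "\<alpha> * R \<le> m / 8 * R\<^sup>2 + 2 / m * \<alpha>\<^sup>2" by simp
    moreover have "m / 8 * R\<^sup>2 \<le> \<delta> / 4" using growth by (simp add: \<delta>_def R_def)
    ultimately show ?thesis by linarith
  qed
  have model: "\<Phi> \<le> - (p * r\<^sup>2)"
    using subgradient_bound[OF u vals(2,1)] descent
    by (simp add: \<Phi>_def r_def inner_add_left)
  have "\<Phi> \<le> c - a + g \<bullet> (z - x) + (g + u) \<bullet> d + (g + u) \<bullet> (x - z)"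
    using subgradient_bound[OF u vals(2,3)]
    by (simp add: \<Phi>_def inner_add_left inner_add_right inner_diff_right)
  also have "\<dots> \<le> - \<delta> + (g - gradf x) \<bullet> (z - x) + (g + u) \<bullet> (x - z)"
  proof -
    have "(g + u) \<bullet> d \<le> 0"
      by (rule order_trans[OF descent]) (use p in simp)
    then show ?thesis
      using convex_on_gradient_lower_bound[OF grad fconv, of x z]
      by (simp add: \<delta>_def inner_diff_left)
  qed
  also have "\<dots> \<le> - \<delta> + e * R + (2 * \<kappa> * r) * R"
  proof -
    have "(g - gradf x) \<bullet> (z - x) \<le> norm (g - gradf x) * R"
      unfolding R_def by (metis norm_cauchy_schwarz norm_minus_commute)
    also have "\<dots> \<le> e * R" using err by (intro mult_right_mono) (auto simp: R_def)
    finally have 1: "(g - gradf x) \<bullet> (z - x) \<le> e * R" .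
    have "(g + u) \<bullet> (x - z) \<le> norm (g + u) * R"
      unfolding R_def by (rule norm_cauchy_schwarz)
    also have "\<dots> \<le> (2 * \<kappa> * r) * R" using bnd by (intro mult_right_mono) (auto simp: R_def r_def)
    finally show ?thesis using 1 by linarith
  qed
  also have "\<dots> \<le> - \<delta> / 2 + 2 / m * e\<^sup>2 + 2 / m * (2 * \<kappa> * r)\<^sup>2"
    using young[of e] young[of "2 * \<kappa> * r"] by linarith
  finally have main: "\<Phi> \<le> - \<delta> / 2 + 2 / m * e\<^sup>2 + 8 * \<kappa>\<^sup>2 / m * r\<^sup>2"
    by (simp add: power_mult_distrib)
  have "2 * p * \<Phi> \<le> 2 * p * (- \<delta> / 2 + 2 / m * e\<^sup>2 + 8 * \<kappa>\<^sup>2 / m * r\<^sup>2)"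
    using main p by (intro mult_left_mono) auto
  moreover have "16 * \<kappa>\<^sup>2 / m * \<Phi> \<le> 16 * \<kappa>\<^sup>2 / m * (- (p * r\<^sup>2))"
    using model m by (intro mult_left_mono) auto
  ultimately show ?thesis
    unfolding \<Phi>_def[symmetric] \<delta>_def[symmetric] by (simp add: algebra_simps)
qed

lemma zopn_iteration_contraction:
  fixes f :: "real^'n \<Rightarrow> real" and H :: "real^'n^'n"
  defines "N \<equiv> real CARD('n)"
  assumes grad: "\<And>y. GDERIV f y :> gradf y" and L: "0 < L" and lip: "L-lipschitz_on UNIV gradf"
    and h: "proper_fun h" "convex_fun h" and fconv: "convex_on UNIV f" and m: "0 < m"
    and growth: "\<And>y. composite f h z + ereal (m / 2 * (norm (y - z))\<^sup>2) \<le> composite f h y"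
    and pars: "0 < c1" "c1 < 1 / 2" "0 < c2" "0 < \<beta>" "0 < \<gamma>" "\<gamma> \<le> 1" "0 < tbar"
    and bounds: "mat lo \<preceq>\<^sub>L H" "H \<preceq>\<^sub>L mat up" and lo: "0 < lo"
    and dir: "inexact_direction h \<gamma> g H x d"
    and step: "backtracking_result (sufficient_decrease f h c1 c2 \<Delta> g x d) tbar \<beta> t"
    and err: "norm (g - gradf x) \<le> \<kappa>eg * \<Delta>" and \<kappa>eg: "0 < \<kappa>eg"
    and tlow: "tlow = \<beta> * min 1 (min (lo * \<gamma> * (1 - 2 * c1) / L) (2 * lo * \<gamma> * N * c2 / \<kappa>eg\<^sup>2))"
    and tbar: "tlow \<le> tbar"
    and vals: "h x = ereal a" "h z = ereal c"
    and \<theta>: "\<theta> = c1 * tlow * lo * \<gamma> / (4 * lo * \<gamma> + 16 * up\<^sup>2 / m + 2 * L)"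
  shows "\<exists>a'. h (x + t *\<^sub>R d) = ereal a' \<and>
    f (x + t *\<^sub>R d) + a' - (f z + c)
      \<le> (1 - \<theta>) * (f x + a - (f z + c)) + (N * c2 + \<theta> * (1 / L + 8 / m) * \<kappa>eg\<^sup>2) * \<Delta>\<^sup>2"
proof -
  define p where "p = lo * \<gamma>"
  define smax where "smax = min 1 (min (p * (1 - 2 * c1) / L) (2 * p * N * c2 / \<kappa>eg\<^sup>2))"
  define D where "D = 4 * p + 16 * up\<^sup>2 / m + 2 * L"
  have p: "0 < p" using lo pars by (simp add: p_def)
  have N: "0 < N" by (simp add: N_def)
  have D: "0 < D" using p m L by (simp add: D_def add_pos_nonneg)
  have smax: "0 < smax" using p L \<kappa>eg N pars by (simp add: smax_def)
  have tl: "tlow = \<beta> * smax" by (simp add: tlow smax_def p_def mult.assoc)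
  have tl_pos: "0 < tlow" using smax pars by (simp add: tl)
  have \<theta>D: "\<theta> = c1 * tlow * p / D" by (simp add: \<theta> D_def p_def mult.assoc)
  obtain u where u: "u \<in> subdifferential h (x + d)"
    and descent: "(g + u) \<bullet> d \<le> - (p * (norm d)\<^sup>2)" and bnd: "norm (g + u) \<le> 2 * up * norm d"
    using inexact_direction_subgradient[OF bounds lo pars(5,6) dir] unfolding p_def by metis
  obtain b where b: "h (x + d) = ereal b"
    using u by (auto simp: subdifferential_def)
  define \<Phi> where "\<Phi> = g \<bullet> d + b - a"
  define \<delta> where "\<delta> = f x + a - (f z + c)"
  have model: "\<Phi> \<le> - (p * (norm d)\<^sup>2)"
    using subgradient_bound[OF u b vals(1)] descent by (simp add: \<Phi>_def inner_add_left)
  then have \<Phi>0: "\<Phi> \<le> 0"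
    by (rule order_trans) (use p in simp)
  have accept: "sufficient_decrease f h c1 c2 \<Delta> g x d s
      \<longleftrightarrow> composite f h (x + s *\<^sub>R d) \<le> ereal (f x + a + c1 * s * \<Phi> + N * c2 * \<Delta>\<^sup>2)" for s
  proof -
    have "model_decrease h g x d = ereal \<Phi>"
      using b vals by (simp add: model_decrease_def \<Phi>_def)
    then show ?thesis
      using vals by (cases "composite f h (x + s *\<^sub>R d)")
        (auto simp: sufficient_decrease_def composite_def[of f h x] N_def algebra_simps)
  qed
  have short: "sufficient_decrease f h c1 c2 \<Delta> g x d s" if s: "0 < s" "s \<le> smax" for s
    unfolding accept \<Phi>_def
  proof (rule short_step_decrease[OF grad lip h(2) vals(1) b _ p err])
    show "g \<bullet> d + b - a \<le> - (p * (norm d)\<^sup>2)" using model by (simp add: \<Phi>_def)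
    show "L * s \<le> p * (1 - 2 * c1)" using s L by (simp add: smax_def field_simps)
    have "s * \<kappa>eg\<^sup>2 \<le> 2 * p * N * c2" using s \<kappa>eg by (simp add: smax_def field_simps)
    then have "(s * \<kappa>eg\<^sup>2) * \<Delta>\<^sup>2 \<le> (2 * p * N * c2) * \<Delta>\<^sup>2" by (rule mult_right_mono) simp
    then show "s * (\<kappa>eg * \<Delta>)\<^sup>2 \<le> 2 * p * (N * c2 * \<Delta>\<^sup>2)"
      by (simp add: power_mult_distrib mult_ac)
  qed (use s pars in \<open>auto simp: smax_def\<close>)
  have t: "tlow \<le> t"
    using backtracking_result_lower_bound[OF step pars(4,7) short] tbar by (simp add: tl)
  have "sufficient_decrease f h c1 c2 \<Delta> g x d t"
    using step by (auto simp: backtracking_result_def)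
  then have dec: "composite f h (x + t *\<^sub>R d) \<le> ereal (f x + a + c1 * t * \<Phi> + N * c2 * \<Delta>\<^sup>2)"
    by (simp add: accept)
  then obtain a' where a': "h (x + t *\<^sub>R d) = ereal a'"
    using h(1) by (cases "h (x + t *\<^sub>R d)") (auto simp: composite_def proper_fun_def)
  have gr: "m / 2 * (norm (x - z))\<^sup>2 \<le> f x + a - (f z + c)"
    using growth[of x] vals by (simp add: composite_def)
  have gap: "(2 * p + 16 * up\<^sup>2 / m) * \<Phi> \<le> - p * \<delta> + 4 * p / m * (\<kappa>eg * \<Delta>)\<^sup>2"
    unfolding \<Phi>_def \<delta>_def
    by (rule model_decrease_controls_gap[OF grad fconv m vals(1) b vals(2) gr u descent p bnd err])
  \<comment> \<open>The constants of the rate leave slack: \<open>D\<close> exceeds \<open>2 p + 16 up\<^sup>2 / m\<close>, and \<open>\<Phi> \<le> 0\<close>.\<close>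
  have "D * \<Phi> \<le> (2 * p + 16 * up\<^sup>2 / m) * \<Phi>"
    using \<Phi>0 p L by (intro mult_right_mono_neg) (auto simp: D_def)
  also note gap
  also have "- p * \<delta> + 4 * p / m * (\<kappa>eg * \<Delta>)\<^sup>2 \<le> - p * \<delta> + p * (1 / L + 8 / m) * (\<kappa>eg * \<Delta>)\<^sup>2"
  proof -
    have "4 / m \<le> 1 / L + 8 / m" using L m by (simp add: add_increasing divide_right_mono)
    then have "p * (4 / m) \<le> p * (1 / L + 8 / m)" using p by (intro mult_left_mono) auto
    then have "p * (4 / m) * (\<kappa>eg * \<Delta>)\<^sup>2 \<le> p * (1 / L + 8 / m) * (\<kappa>eg * \<Delta>)\<^sup>2"
      by (rule mult_right_mono) simp
    then show ?thesis by (simp add: mult.commute)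
  qed
  finally have "\<Phi> \<le> (p * ((1 / L + 8 / m) * (\<kappa>eg * \<Delta>)\<^sup>2 - \<delta>)) / D"
    using D by (simp add: pos_le_divide_eq algebra_simps)
  then have "c1 * tlow * \<Phi> \<le> c1 * tlow * ((p * ((1 / L + 8 / m) * (\<kappa>eg * \<Delta>)\<^sup>2 - \<delta>)) / D)"
    using tl_pos pars by (intro mult_left_mono) auto
  also have "\<dots> = \<theta> * ((1 / L + 8 / m) * (\<kappa>eg * \<Delta>)\<^sup>2 - \<delta>)"
    by (simp add: \<theta>D)
  finally have 1: "c1 * tlow * \<Phi> \<le> \<theta> * ((1 / L + 8 / m) * (\<kappa>eg * \<Delta>)\<^sup>2 - \<delta>)" .
  have "c1 * t * \<Phi> \<le> c1 * tlow * \<Phi>"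
    using t \<Phi>0 pars by (intro mult_right_mono_neg mult_left_mono) auto
  then have "f (x + t *\<^sub>R d) + a' - (f z + c)
      \<le> \<delta> + \<theta> * ((1 / L + 8 / m) * (\<kappa>eg * \<Delta>)\<^sup>2 - \<delta>) + N * c2 * \<Delta>\<^sup>2"
    using dec a' 1 by (simp add: composite_def \<delta>_def)
  also have "\<dots> = (1 - \<theta>) * \<delta> + (N * c2 + \<theta> * (1 / L + 8 / m) * \<kappa>eg\<^sup>2) * \<Delta>\<^sup>2"
    by (simp add: algebra_simps power_mult_distrib)
  finally show ?thesis using a' by (auto simp: \<delta>_def)
qed

lemma linear_recurrence_bound:
  fixes \<delta> D :: "nat \<Rightarrow> real"
  assumes \<tau>: "0 < \<tau>" and rec: "\<And>k. k < T \<Longrightarrow> \<delta> (Suc k) \<le> \<tau> * \<delta> k + C * D k"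
    and T: "1 \<le> T"
  shows "\<delta> T \<le> \<tau> ^ T * \<delta> 0 + C * \<tau> ^ (T - 1) * (\<Sum>k<T. D k / \<tau> ^ k)"
proof -
  have "\<delta> n \<le> \<tau> ^ n * \<delta> 0 + C * \<tau> ^ n * (\<Sum>k<n. D k / \<tau> ^ k) / \<tau>" if "n \<le> T" for n
    using that
  proof (induction n)
    case (Suc n)
    have "\<delta> (Suc n) \<le> \<tau> * \<delta> n + C * D n" using rec Suc.prems by simp
    also have "\<dots> \<le> \<tau> * (\<tau> ^ n * \<delta> 0 + C * \<tau> ^ n * (\<Sum>k<n. D k / \<tau> ^ k) / \<tau>) + C * D n"
      using Suc \<tau> by simp
    also have "\<dots> = \<tau> ^ Suc n * \<delta> 0 + C * \<tau> ^ Suc n * (\<Sum>k<Suc n. D k / \<tau> ^ k) / \<tau>"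
      using \<tau> by (simp add: field_simps)
    finally show ?case .
  qed simp
  from this[of T] show ?thesis
    using T \<tau> by (cases T) auto
qed

theorem lemma3p6:
  fixes f :: "real^'n \<Rightarrow> real" and gradf :: "real^'n \<Rightarrow> real^'n" and h :: "real^'n \<Rightarrow> ereal"
    and \<epsilon> c1 c2 \<beta> \<gamma> tbar Lf Flow \<kappa>eg \<kappa>lo \<kappa>up m tlow \<tau> \<omega> :: real
    and \<Delta> t :: "nat \<Rightarrow> real" and g x d :: "nat \<Rightarrow> real^'n" and H :: "nat \<Rightarrow> real^'n^'n"
    and T :: nat
  assumes grad: "\<And>y. GDERIV f y :> gradf y"
    and cont: "continuous_on UNIV gradf"
    and Lf_pos: "Lf > 0"
    and lip: "Lf-lipschitz_on UNIV gradf"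
    and h: "proper_fun h" "closed_fun h" "convex_fun h"
    and bounded_below: "\<And>y. ereal Flow \<le> composite f h y"
    and f_convex: "convex_on UNIV f"
    and m_pos: "m > 0"
    and F_strongly_convex: "composite_strongly_convex m f gradf h"
    and \<kappa>eg_pos: "\<kappa>eg > 0"
    and \<kappa>_bounds: "0 < \<kappa>lo" "\<kappa>lo \<le> \<kappa>up"
    and T: "T \<ge> 1"
    and run: "zopn_run f h \<epsilon> c1 c2 \<beta> \<gamma> tbar \<Delta> g H x d t T"
    and grad_error: "\<And>k. k < T \<Longrightarrow> norm (g k - gradf (x k)) \<le> \<kappa>eg * \<Delta> k"
    and hess_bounds: "\<And>k. k < T \<Longrightarrow> mat \<kappa>lo \<preceq>\<^sub>L H k \<and> H k \<preceq>\<^sub>L mat \<kappa>up"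
    and tlow: "tlow = \<beta> * min 1 (min (\<kappa>lo * \<gamma> * (1 - 2 * c1) / Lf)
                                    (2 * \<kappa>lo * \<gamma> * real CARD('n) * c2 / \<kappa>eg\<^sup>2))"
    and \<tau>: "\<tau> = 1 - c1 * tlow * \<kappa>lo * \<gamma> / (4 * \<kappa>lo * \<gamma> + 16 * \<kappa>up\<^sup>2 / m + 2 * Lf)"
    and \<omega>: "\<omega> = c1 * tlow * \<kappa>lo * \<gamma> * (1 / Lf + 8 / m)
                / (4 * \<kappa>lo * \<gamma> + 16 * \<kappa>up\<^sup>2 / m + 2 * Lf)"
    and tbar_ge: "tlow \<le> tbar"
  shows "0 < \<tau> \<and> \<tau> < 1 \<and> 0 < \<omega> \<and>
    (\<exists>!z. is_arg_min (composite f h) (\<lambda>_. True) z) \<and>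
    (\<forall>xstar. is_arg_min (composite f h) (\<lambda>_. True) xstar \<longrightarrow>
       composite f h (x T) - composite f h xstar
         \<le> ereal (\<tau> ^ T) * (composite f h (x 0) - composite f h xstar)
            + ereal ((real CARD('n) * c2 + \<omega> * \<kappa>eg\<^sup>2) * \<tau> ^ (T - 1)
                     * (\<Sum>k<T. (\<Delta> k)\<^sup>2 / \<tau> ^ k)))"
proof -
  let ?F = "composite f h"
  define \<theta> where "\<theta> = c1 * tlow * \<kappa>lo * \<gamma> / (4 * \<kappa>lo * \<gamma> + 16 * \<kappa>up\<^sup>2 / m + 2 * Lf)"
  define D where "D = 4 * (\<kappa>lo * \<gamma>) + 16 * \<kappa>up\<^sup>2 / m + 2 * Lf"
  have inputs: "x 0 \<in> effective_domain ?F" "0 < c1" "c1 < 1 / 2" "0 < c2" "0 < \<beta>" "\<beta> < 1"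
    "0 < \<gamma>" "\<gamma> \<le> 1" "0 < tbar"
    using run by (auto simp: zopn_run_def zopn_inputs_def)
  have iter: "inexact_direction h \<gamma> (g k) (H k) (x k) (d k)"
    "backtracking_result (sufficient_decrease f h c1 c2 (\<Delta> k) (g k) (x k) (d k)) tbar \<beta> (t k)"
    "x (Suc k) = x k + t k *\<^sub>R d k" if "k < T" for k
    using run that by (auto simp: zopn_run_def)
  have notm: "h y \<noteq> -\<infinity>" for y using h(1) by (auto simp: proper_fun_def)

  have p: "0 < \<kappa>lo * \<gamma>" using \<kappa>_bounds inputs by simp
  have "0 \<le> 16 * \<kappa>up\<^sup>2 / m" using m_pos by simp
  then have D: "\<kappa>lo * \<gamma> < D" "0 < D" using p Lf_pos unfolding D_def by linarith+
  have tlow_pos: "0 < tlow"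
    using \<kappa>_bounds inputs Lf_pos \<kappa>eg_pos by (simp add: tlow)
  have "tlow \<le> \<beta> * 1" unfolding tlow using inputs by (intro mult_left_mono) auto
  then have "c1 * tlow < 1 * 1" using inputs tlow_pos by (intro mult_strict_mono) auto
  then have "(c1 * tlow) * (\<kappa>lo * \<gamma>) < 1 * D"
    using D p inputs tlow_pos by (intro mult_strict_mono) auto
  moreover have \<theta>D: "\<theta> = (c1 * tlow) * (\<kappa>lo * \<gamma>) / D" by (simp add: \<theta>_def D_def mult.assoc)
  ultimately have \<theta>: "0 < \<theta>" "\<theta> < 1"
    using D p inputs tlow_pos by auto
  have \<tau>\<theta>: "\<tau> = 1 - \<theta>" by (simp add: \<tau> \<theta>_def)
  have \<omega>\<theta>: "\<omega> = \<theta> * (1 / Lf + 8 / m)" by (simp add: \<omega> \<theta>_def)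
  have \<omega>_pos: "0 < \<omega>" using \<theta> Lf_pos m_pos by (simp add: \<omega>\<theta> add_pos_pos)

  have contf: "continuous_on UNIV f"
    using grad by (auto simp: continuous_on_eq_continuous_within gderiv_def
        intro: has_derivative_continuous)
  \<comment> \<open>The first computed direction provides a point at which \<open>\<partial>F\<close> is nonempty.\<close>
  obtain u0 where "u0 \<in> subdifferential h (x 0 + d 0)"
    using iter(1)[of 0] T by (auto simp: inexact_direction_def)
  then have "gradf (x 0 + d 0) + u0 \<in> composite_subdifferential gradf h (x 0 + d 0)"
    by (simp add: composite_subdifferential_def)
  from strongly_convex_has_minimizer[OF contf h(1,2) F_strongly_convex m_pos this]
  obtain z0 where z0: "\<And>y. ?F z0 \<le> ?F y" by blast
  have growth: "?F z + ereal (m / 2 * (norm (y - z))\<^sup>2) \<le> ?F y" if "\<And>y. ?F z \<le> ?F y" for z y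
    by (rule strongly_convex_quadratic_growth[OF F_strongly_convex
          minimizer_zero_subgradient[OF grad lip h(1,3) that]])
  obtain a0 where a0: "h (x 0) = ereal a0"
    using inputs(1) notm[of "x 0"]
    by (cases "h (x 0)") (auto simp: effective_domain_def composite_def)
  have fin: "\<exists>c. h z = ereal c" if "\<And>y. ?F z \<le> ?F y" for z
    using that[of "x 0"] a0 notm[of z] by (cases "h z") (auto simp: composite_def)
  have uniq: "y = z" if z: "\<And>w. ?F z \<le> ?F w" and y: "\<And>w. ?F y \<le> ?F w" for y z
  proof -
    obtain c where c: "h z = ereal c" using fin[OF z] by blast
    obtain c' where c': "h y = ereal c'" using fin[OF y] by blast
    have "m / 2 * (norm (y - z))\<^sup>2 \<le> 0"
      using growth[OF z, of y] y[of z] c c' by (simp add: composite_def)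
    then show ?thesis using m_pos by (simp add: mult_le_0_iff)
  qed
  have argmin: "is_arg_min ?F (\<lambda>_. True) z \<longleftrightarrow> (\<forall>y. ?F z \<le> ?F y)" for z
    by (auto simp: is_arg_min_def not_less)
  have ex1: "\<exists>!z. is_arg_min ?F (\<lambda>_. True) z"
    unfolding argmin using z0 uniq by blast

  have "?F (x T) - ?F z
         \<le> ereal (\<tau> ^ T) * (?F (x 0) - ?F z)
            + ereal ((real CARD('n) * c2 + \<omega> * \<kappa>eg\<^sup>2) * \<tau> ^ (T - 1)
                     * (\<Sum>k<T. (\<Delta> k)\<^sup>2 / \<tau> ^ k))"
    if "is_arg_min ?F (\<lambda>_. True) z" for z
  proof -
    have z: "\<And>y. ?F z \<le> ?F y" using that by (simp add: argmin)
    obtain c where c: "h z = ereal c" using fin[OF z] by blast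
    have step: "\<exists>a'. h (x (Suc k)) = ereal a' \<and>
        f (x (Suc k)) + a' - (f z + c)
          \<le> \<tau> * (f (x k) + a - (f z + c)) + (real CARD('n) * c2 + \<omega> * \<kappa>eg\<^sup>2) * (\<Delta> k)\<^sup>2"
      if k: "k < T" and a: "h (x k) = ereal a" for k a
      unfolding iter(3)[OF k] \<tau>\<theta> \<omega>\<theta>
      by (rule zopn_iteration_contraction[OF grad Lf_pos lip h(1,3) f_convex m_pos growth[OF z]
            inputs(2-5,7-9) conjunct1[OF hess_bounds[OF k]] conjunct2[OF hess_bounds[OF k]]
            \<kappa>_bounds(1) iter(1,2)[OF k] grad_error[OF k] \<kappa>eg_pos tlow tbar_ge a c \<theta>_def])
    define A where "A k = real_of_ereal (h (x k))" for k
    have A: "h (x k) = ereal (A k)" if "k \<le> T" for k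
      using that
    proof (induction k)
      case (Suc k)
      then show ?case using step[of k "A k"] by (auto simp: A_def)
    qed (simp add: a0 A_def)
    define \<delta> where "\<delta> k = f (x k) + A k - (f z + c)" for k
    have "\<delta> T \<le> \<tau> ^ T * \<delta> 0
        + (real CARD('n) * c2 + \<omega> * \<kappa>eg\<^sup>2) * \<tau> ^ (T - 1) * (\<Sum>k<T. (\<Delta> k)\<^sup>2 / \<tau> ^ k)"
    proof (rule linear_recurrence_bound[OF _ _ T])
      show "0 < \<tau>" using \<theta> by (simp add: \<tau>\<theta>)
      show "\<delta> (Suc k) \<le> \<tau> * \<delta> k + (real CARD('n) * c2 + \<omega> * \<kappa>eg\<^sup>2) * (\<Delta> k)\<^sup>2" if "k < T" for k
        using step[OF that A] A[of "Suc k"] that by (auto simp: \<delta>_def)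
    qed
    then show ?thesis
      using A[of T] A[of 0] c by (simp add: composite_def \<delta>_def)
  qed
  then show ?thesis
    using \<theta> \<omega>_pos ex1 by (simp add: \<tau>\<theta>)
qed

end
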